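(* For an integer $k\ge 1$, let ${\cal D}_n^k$ be the hypergraph on vertex set $E(K_n)$ whose hyperedges are the edge sets of all graphs on the vertex set of $K_n$ which are not $k$-degenerate, and let $e(n)=(n-k)k+\binom{k}{2}$. If $k=k(n)=o(\log n)$, then (for all sufficiently large $n$) $\tau_E({\cal D}_n^k)=e(n)+1$.
   Context: A graph $G$ is $k$-degenerate if every subgraph of $G$ has a vertex of degree at most $k$; a $k$-degenerate graph on $n$ vertices has at most $e(n)$ edges. Avoider-Enforcer game on a hypergraph ${\cal F}$ with vertex set (board) $E(K_n)$: two players, Avoider and Enforcer, alternately claim previously unclaimed edges of $K_n$, one edge per move, Avoider moving first, until all edges are claimed. Enforcer wins if at some point the set of edges claimed by Avoider contains all elements of some hyperedge (losing set) of ${\cal F}$; otherwise Avoider wins. $\tau_E({\cal F})$ denotes the smallest integer $t$ such that Enforcer has a strategy to win the game ${\cal F}$ in at most $t$ moves (i.e., forcing Avoider to complete a losing set within his first $t$ moves), with $\tau_E({\cal F})=\infty$ if the game is an Avoider's win. $\log$ is the natural logarithm. *)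

theory Defs
  imports Complex_Main "HOL-Library.Landau_Symbols" "HOL-Library.Extended_Nat"
begin

definition complete_edges :: "'a set \<Rightarrow> 'a set set" where
  "complete_edges V = {e. e \<subseteq> V \<and> card e = 2}"

definition is_graph :: "'a set \<Rightarrow> 'a set set \<Rightarrow> bool" where
  "is_graph V E \<longleftrightarrow> E \<subseteq> complete_edges V"

definition is_subgraph :: "'a set \<Rightarrow> 'a set set \<Rightarrow> 'a set \<Rightarrow> 'a set set \<Rightarrow> bool" where
  "is_subgraph V' E' V E \<longleftrightarrow> is_graph V' E' \<and> V' \<subseteq> V \<and> E' \<subseteq> E"

definition vertex_degree :: "'a set set \<Rightarrow> 'a \<Rightarrow> nat" where
  "vertex_degree E v = card {e \<in> E. v \<in> e}"

definition degenerate :: "nat \<Rightarrow> 'a set \<Rightarrow> 'a set set \<Rightarrow> bool" where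
  "degenerate k V E \<longleftrightarrow>
     (\<forall>V' E'. is_subgraph V' E' V E \<and> V' \<noteq> {} \<longrightarrow> (\<exists>v\<in>V'. vertex_degree E' v \<le> k))"

text \<open>
  A play is recorded as the list of all claimed elements in the order in which they are
  claimed. Avoider moves first, so he owns the even positions (counting from 0) and Enforcer
  the odd ones.
\<close>

definition complete_play :: "'b set \<Rightarrow> 'b list \<Rightarrow> bool" where
  "complete_play X p \<longleftrightarrow> distinct p \<and> set p = X"

definition avoider_claims :: "nat \<Rightarrow> 'b list \<Rightarrow> 'b set" where
  "avoider_claims t p = {p ! (2 * i) |i. i < t \<and> 2 * i < length p}"

definition enforcer_strategy :: "'b set \<Rightarrow> ('b list \<Rightarrow> 'b) \<Rightarrow> bool" where
  "enforcer_strategy X s \<longleftrightarrow>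
     (\<forall>h. distinct h \<and> set h \<subset> X \<and> odd (length h) \<longrightarrow> s h \<in> X - set h)"

definition follows :: "('b list \<Rightarrow> 'b) \<Rightarrow> 'b list \<Rightarrow> bool" where
  "follows s p \<longleftrightarrow> (\<forall>i < length p. odd i \<longrightarrow> p ! i = s (take i p))"

definition enforcer_wins_within :: "'b set \<Rightarrow> 'b set set \<Rightarrow> nat \<Rightarrow> bool" where
  "enforcer_wins_within X F t \<longleftrightarrow>
     (\<exists>s. enforcer_strategy X s \<and>
        (\<forall>p. complete_play X p \<and> follows s p \<longrightarrow> (\<exists>A\<in>F. A \<subseteq> avoider_claims t p)))"

text \<open>The infimum of the empty set in \<^typ>\<open>enat\<close> is \<open>\<infinity>\<close>.\<close>

definition tau_E :: "'b set \<Rightarrow> 'b set set \<Rightarrow> enat" where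
  "tau_E X F = Inf {enat t |t. enforcer_wins_within X F t}"

text \<open>The vertex set of \<open>K\<^sub>n\<close> is \<open>{..<n}\<close>.\<close>

definition non_degenerate_hypergraph :: "nat \<Rightarrow> nat \<Rightarrow> nat set set set" where
  "non_degenerate_hypergraph n k = {E. is_graph {..<n} E \<and> \<not> degenerate k {..<n} E}"

text \<open>
  Subtraction on \<^typ>\<open>nat\<close> truncates, so this is \<open>(n - k) k + (k choose 2)\<close> in the
  usual sense only for \<open>k \<le> n\<close>.
\<close>

definition max_degenerate_edges :: "nat \<Rightarrow> nat \<Rightarrow> nat" where
  "max_degenerate_edges n k = (n - k) * k + (k choose 2)"

end

theory Submission
  imports Defs
begin

text \<open>
  A \<open>k\<close>-degenerate graph has at most \<open>e(n)\<close> edges, so Enforcer wins within \<open>e(n) + 1\<close> moves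
  whatever he plays. Conversely, Avoider can make his first \<open>e(n)\<close> edges form a \<open>k\<close>-degenerate graph.

  He first builds a core: a \<open>k\<close>-clique \<open>C\<close> completely joined to a set \<open>L\<close> with \<open>4 ^ k\<close> elements.
  Starting from \<open>16 ^ k\<close> candidates he repeatedly picks a candidate that Enforcer has hardly touched
  and joins it to a quarter of the candidates, which become the new candidates. This takes at most
  \<open>16 ^ k = n ^ o(1)\<close> moves, and all his edges meet \<open>C\<close>.

  Afterwards every vertex outside \<open>C\<close> has to reach \<open>k\<close> edges to earlier vertices in the order \<open>C\<close>,
  \<open>L\<close>, the vertices not yet touched by Enforcer, the touched ones. An untouched vertex has all of
  \<open>C \<union> L\<close> at its disposal, a touched one almost all vertices, as there are at most \<open>2 * 16 ^ k\<close> touched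
  ones. Each edge has one later endpoint, and Avoider answers an edge claimed by Enforcer with
  another edge going back from the same later endpoint; so no vertex runs out of free edges.
\<close>

section \<open>Forcing positions in the game\<close>

text \<open>
  \<open>A\<close> and \<open>E\<close> are the elements claimed by Avoider and Enforcer. A round in which Avoider takes the
  last free element counts as a success; this is harmless as long as \<open>2 * j \<le> card X\<close>.
\<close>

fun force :: "'b set \<Rightarrow> nat \<Rightarrow> ('b set \<Rightarrow> 'b set \<Rightarrow> bool) \<Rightarrow> 'b set \<Rightarrow> 'b set \<Rightarrow> bool" where
  "force X 0 P A E \<longleftrightarrow> P A E"
| "force X (Suc j) P A E \<longleftrightarrow>
     (\<exists>a\<in>X - (A \<union> E). \<forall>b\<in>X - insert a (A \<union> E). force X j P (insert a A) (insert b E))"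

lemma force_mono:
  assumes "force X j P A E" "\<And>A E. P A E \<Longrightarrow> Q A E"
  shows "force X j Q A E"
  using assms(1)
proof (induction j arbitrary: A E)
  case 0
  then show ?case using assms(2) by simp
next
  case (Suc j)
  then show ?case by (metis force.simps(2))
qed

text \<open>Joins two phases of Avoider's strategy; the second may depend on the position reached by
  the first.\<close>

lemma force_add:
  assumes "force X i (force X j P) A E"
  shows "force X (i + j) P A E"
  using assms
proof (induction i arbitrary: A E)
  case 0
  then show ?case by simp
next
  case (Suc i)
  then show ?case by (metis force.simps(2) add_Suc)
qed

text \<open>Enforcer gains exactly one element per round; this count is how later phases bound the
  damage he has done.\<close>

lemma force_card:
  assumes "force X j P A E" "finite X" "A \<subseteq> X" "E \<subseteq> X" "A \<inter> E = {}"
  shows "force X j (\<lambda>A' E'. P A' E' \<and> A' \<subseteq> X \<and> E' \<subseteq> X \<and> A' \<inter> E' = {} \<and>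
           card A' = card A + j \<and> card E' = card E + j) A E"
  using assms
proof (induction j arbitrary: A E)
  case 0
  then show ?case by simp
next
  case (Suc j)
  from Suc.prems(1) obtain a where a: "a \<in> X - (A \<union> E)"
    and f: "\<And>b. b \<in> X - insert a (A \<union> E) \<Longrightarrow> force X j P (insert a A) (insert b E)"
    by auto
  have fin: "finite A" "finite E"
    using Suc.prems by (auto intro: finite_subset)
  have "force X j (\<lambda>A' E'. P A' E' \<and> A' \<subseteq> X \<and> E' \<subseteq> X \<and> A' \<inter> E' = {} \<and>
           card A' = card A + Suc j \<and> card E' = card E + Suc j) (insert a A) (insert b E)"
    if b: "b \<in> X - insert a (A \<union> E)" for b
    using Suc.IH[OF f[OF b]] Suc.prems a b fin by auto
  with a show ?case by auto
qed

section \<open>From forcing to plays against a given Enforcer strategy\<close>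

lemma avoider_claims_append:
  assumes "length h = 2 * i"
  shows "avoider_claims (Suc i) (h @ [a, b]) = insert a (avoider_claims i h)"
proof -
  have "{(h @ [a, b]) ! (2 * l) |l. l < Suc i \<and> 2 * l < length (h @ [a, b])} =
      (\<lambda>l. (h @ [a, b]) ! (2 * l)) ` {..<Suc i}"
    using assms by auto
  also have "\<dots> = insert a ((\<lambda>l. (h @ [a, b]) ! (2 * l)) ` {..<i})"
    unfolding lessThan_Suc image_insert using nth_append_length[of h a "[b]"] assms by simp
  also have "(\<lambda>l. (h @ [a, b]) ! (2 * l)) ` {..<i} = (\<lambda>l. h ! (2 * l)) ` {..<i}"
    using assms by (intro image_cong) (auto simp: nth_append)
  also have "\<dots> = avoider_claims i h"
    unfolding avoider_claims_def using assms by auto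
  finally show ?thesis by (simp add: avoider_claims_def)
qed

lemma follows_snoc:
  assumes "follows s h" "odd (length h) \<Longrightarrow> x = s h"
  shows "follows s (h @ [x])"
  using assms by (auto simp: follows_def nth_append less_Suc_eq)

text \<open>Runs the forcing strategy against \<open>s\<close>. The bound on \<open>card X\<close>
  leaves Enforcer a free element in each of these rounds, so the quantifier over his replies in
  \<open>force\<close> is never vacuous.\<close>

lemma force_history:
  assumes s: "enforcer_strategy X s" and X: "finite X"
    and "force X j P A E"
    and "distinct h" "set h = A \<union> E" "A \<union> E \<subseteq> X" "length h = 2 * i" "follows s h"
    and "avoider_claims i h = A" "2 * (i + j) \<le> card X"
  shows "\<exists>h' E'. distinct h' \<and> set h' \<subseteq> X \<and> length h' = 2 * (i + j) \<and> follows s h' \<and>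
           P (avoider_claims (i + j) h') E'"
  using assms(3-)
proof (induction j arbitrary: A E h i)
  case 0
  then show ?case by auto
next
  case (Suc j)
  from Suc.prems(1) obtain a where a: "a \<in> X - (A \<union> E)"
    and f: "\<And>b. b \<in> X - insert a (A \<union> E) \<Longrightarrow> force X j P (insert a A) (insert b E)"
    by auto
  define b where "b = s (h @ [a])"
  have d: "distinct (h @ [a])" using Suc.prems a by auto
  \<comment> \<open>Only \<open>2 * i + 1\<close> elements are claimed, while the board has at least
    \<open>2 * i + 2\<close>.\<close>
  have "card (set (h @ [a])) = 2 * i + 1"
    using d Suc.prems by (metis distinct_card length_append_singleton Suc_eq_plus1)
  then have "set (h @ [a]) \<noteq> X" using Suc.prems(8) by auto
  then have "set (h @ [a]) \<subset> X" using Suc.prems a by auto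
  then have "b \<in> X - set (h @ [a])"
    using s d Suc.prems(5) unfolding enforcer_strategy_def b_def
    by (metis even_mult_iff even_numeral length_append_singleton even_Suc)
  then have b: "b \<in> X - insert a (A \<union> E)" using Suc.prems by auto
  have "follows s ((h @ [a]) @ [b])"
    using Suc.prems(5,6) by (intro follows_snoc) (auto simp: b_def)
  then have "\<exists>h' E'. distinct h' \<and> set h' \<subseteq> X \<and> length h' = 2 * (Suc i + j) \<and> follows s h' \<and>
           P (avoider_claims (Suc i + j) h') E'"
    using Suc.prems a b avoider_claims_append[OF Suc.prems(5), of a b]
    by (intro Suc.IH[OF f[OF b], of "h @ [a, b]" "Suc i"]) auto
  then show ?case by simp
qed

text \<open>Winning is judged on complete plays, so a partial history is continued by
  \<open>s\<close> on Enforcer's turns and arbitrarily on Avoider's.\<close>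

lemma complete_play_extends:
  assumes s: "enforcer_strategy X s" and X: "finite X"
    and "distinct h" "set h \<subseteq> X" "follows s h"
  shows "\<exists>p. complete_play X p \<and> follows s p \<and> take (length h) p = h"
  using assms(3-)
proof (induction "card X - length h" arbitrary: h)
  case 0
  then have "card (set h) \<ge> card X" by (simp add: distinct_card)
  then have "set h = X" using 0 X by (simp add: card_seteq)
  then show ?case using 0 by (auto simp: complete_play_def)
next
  case (Suc m)
  then have "card (set h) < card X" by (simp add: distinct_card)
  then have ss: "set h \<subset> X" using Suc.prems by auto
  then obtain y where y: "y \<in> X - set h" by auto
  define x where "x = (if odd (length h) then s h else y)"
  have x: "x \<in> X - set h"
    using s ss y Suc.prems unfolding x_def enforcer_strategy_def by auto
  have "follows s (h @ [x])"
    using Suc.prems by (intro follows_snoc) (auto simp: x_def)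
  moreover have "m = card X - length (h @ [x])" using Suc.hyps(2) by simp
  ultimately obtain p where "complete_play X p" "follows s p" "take (length (h @ [x])) p = h @ [x]"
    using Suc.hyps(1)[of "h @ [x]"] Suc.prems x by auto
  moreover from this(3) have "take (length h) p = h"
    by (metis append_eq_conv_conj length_append le_add1 min.absorb1 take_take)
  ultimately show ?case by blast
qed

lemma avoider_claims_take:
  assumes "length h = 2 * j" "take (length h) p = h"
  shows "avoider_claims j p = avoider_claims j h"
proof -
  have "length h \<le> length p" using assms by (metis length_take min.cobounded1)
  moreover have "p ! (2 * l) = h ! (2 * l)" if "l < j" for l
    using that assms by (metis nth_take mult_less_mono2 zero_less_numeral)
  moreover from calculation(1) have "avoider_claims j p = (\<lambda>l. p ! (2 * l)) ` {..<j}"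
    using assms(1) by (auto simp: avoider_claims_def)
  moreover have "avoider_claims j h = (\<lambda>l. h ! (2 * l)) ` {..<j}"
    using assms(1) by (auto simp: avoider_claims_def)
  ultimately show ?thesis by simp
qed

lemma force_play:
  assumes "enforcer_strategy X s" "finite X" "force X j P {} {}" "2 * j \<le> card X"
  obtains p E where "complete_play X p" "follows s p" "P (avoider_claims j p) E"
proof -
  have "\<exists>h E. distinct h \<and> set h \<subseteq> X \<and> length h = 2 * (0 + j) \<and> follows s h \<and>
      P (avoider_claims (0 + j) h) E"
    using assms by (intro force_history[of X s j P "{}" "{}" "[]"])
      (auto simp: follows_def avoider_claims_def)
  then obtain h E where h: "distinct h" "set h \<subseteq> X" "length h = 2 * j" "follows s h"
    "P (avoider_claims j h) E" by auto
  then show thesis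
    using complete_play_extends[OF assms(1,2) h(1,2,4)] avoider_claims_take[OF h(3)] that by metis
qed

lemma avoider_claims_mono: "t \<le> u \<Longrightarrow> avoider_claims t p \<subseteq> avoider_claims u p"
  by (auto simp: avoider_claims_def)

text \<open>Avoider's last counted claim, at position \<open>2 * t - 2\<close>, needs no reply after
  it; hence the \<open>+ 1\<close>.\<close>

lemma card_avoider_claims:
  assumes "distinct p" "2 * t \<le> length p + 1"
  shows "card (avoider_claims t p) = t"
proof -
  have "avoider_claims t p = (\<lambda>i. p ! (2 * i)) ` {..<t}"
    using assms(2) by (auto simp: avoider_claims_def)
  moreover have "inj_on (\<lambda>i. p ! (2 * i)) {..<t}"
    using assms by (auto simp: inj_on_def nth_eq_iff_index_eq)
  ultimately show ?thesis by (simp add: card_image)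
qed

lemma enforcer_strategy_exists: "\<exists>s. enforcer_strategy X s"
proof -
  have "enforcer_strategy X (\<lambda>h. SOME x. x \<in> X - set h)"
    unfolding enforcer_strategy_def by (metis Diff_eq_empty_iff ex_in_conv psubsetE someI_ex)
  then show ?thesis by blast
qed

section \<open>Degenerate graphs\<close>

lemma finite_complete_edges: "finite V \<Longrightarrow> finite (complete_edges V)"
  by (simp add: complete_edges_def)

lemma card_complete_edges: "finite V \<Longrightarrow> card (complete_edges V) = card V choose 2"
  by (simp add: complete_edges_def n_subsets)

lemma complete_edges_mono: "U \<subseteq> V \<Longrightarrow> complete_edges U \<subseteq> complete_edges V"
  by (auto simp: complete_edges_def)

lemma doubleton_in_complete_edges:
  "{u, v} \<in> complete_edges V \<longleftrightarrow> u \<in> V \<and> v \<in> V \<and> u \<noteq> v"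
  by (auto simp: complete_edges_def card_2_iff doubleton_eq_iff)

lemma complete_edges_other_end:
  assumes "e \<in> complete_edges V" "v \<in> e"
  obtains u where "e = {v, u}" "u \<noteq> v" "u \<in> V"
  using assms by (auto simp: complete_edges_def card_2_iff)

lemma degenerate_subset: "degenerate k V E \<Longrightarrow> F \<subseteq> E \<Longrightarrow> degenerate k V F"
  unfolding degenerate_def is_subgraph_def by blast

text \<open>Delete vertices of degree at most \<open>k\<close> one by one until \<open>k\<close>
  vertices remain, which span at most \<open>k choose 2\<close> edges.\<close>

lemma degenerate_card_le:
  assumes "finite V" "k \<le> card V" "is_graph V E" "degenerate k V E"
  shows "card E \<le> (card V - k) * k + (k choose 2)"
  using assms
proof (induction "card V - k" arbitrary: V E)
  case 0
  then have "card V = k" by simp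
  moreover have "card E \<le> card (complete_edges V)"
    using 0 by (intro card_mono finite_complete_edges) (auto simp: is_graph_def)
  ultimately show ?case using 0 by (simp add: card_complete_edges)
next
  case (Suc d)
  then have "V \<noteq> {}" by auto
  then obtain v where v: "v \<in> V" "vertex_degree E v \<le> k"
    using Suc.prems unfolding degenerate_def is_subgraph_def by blast
  define F where "F = {e \<in> E. v \<notin> e}"
  have fin: "finite E"
    using Suc.prems finite_complete_edges finite_subset unfolding is_graph_def by blast
  have graph: "is_graph (V - {v}) F"
    using Suc.prems by (auto simp: is_graph_def complete_edges_def F_def)
  have "degenerate k (V - {v}) F"
    using Suc.prems(4) unfolding degenerate_def is_subgraph_def F_def by blast
  then have "card F \<le> (card (V - {v}) - k) * k + (k choose 2)"
    using Suc v graph by (intro Suc.hyps(1)) auto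
  moreover have "E = F \<union> {e \<in> E. v \<in> e}" "F \<inter> {e \<in> E. v \<in> e} = {}" by (auto simp: F_def)
  then have "card E = card F + vertex_degree E v"
    unfolding vertex_degree_def using fin by (metis card_Un_disjoint finite_Un)
  moreover have "card (V - {v}) - k = d" "card V - k = Suc d"
    using Suc v by auto
  ultimately show ?case using v by simp
qed

text \<open>In a subgraph, every edge at a vertex of maximal rank is counted by the hypothesis. Ties
  are counted too, so \<open>r\<close> may be a coarse layering rather than an ordering.\<close>

lemma degenerate_if_rank:
  fixes r :: "'a \<Rightarrow> nat"
  assumes V: "finite V" and A: "A \<subseteq> complete_edges V"
    and r: "\<And>v. v \<in> V \<Longrightarrow> card {e \<in> A. v \<in> e \<and> (\<forall>u\<in>e. r u \<le> r v)} \<le> k"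
  shows "degenerate k V A"
  unfolding degenerate_def
proof (intro allI impI)
  fix V' E' assume sub: "is_subgraph V' E' V A \<and> V' \<noteq> {}"
  then have "finite V'" using V finite_subset unfolding is_subgraph_def by blast
  then have "Max (r ` V') \<in> r ` V'" using sub by (intro Max_in) auto
  then obtain v where "v \<in> V'" "r v = Max (r ` V')" by auto
  then have v: "v \<in> V'" "\<And>u. u \<in> V' \<Longrightarrow> r u \<le> r v"
    using \<open>finite V'\<close> by auto
  have "finite A" using A V finite_complete_edges finite_subset by blast
  moreover have "{e \<in> E'. v \<in> e} \<subseteq> {e \<in> A. v \<in> e \<and> (\<forall>u\<in>e. r u \<le> r v)}"
    using sub v unfolding is_subgraph_def is_graph_def complete_edges_def by blast
  ultimately have "vertex_degree E' v \<le> card {e \<in> A. v \<in> e \<and> (\<forall>u\<in>e. r u \<le> r v)}"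
    unfolding vertex_degree_def by (intro card_mono) auto
  then show "\<exists>v\<in>V'. vertex_degree E' v \<le> k"
    using r[of v] v sub unfolding is_subgraph_def by (meson le_trans subsetD)
qed

section \<open>Completing a core\<close>

text \<open>Assigns an edge to its end of larger rank. Since the inequality is strict, an edge has
  at most one owner, and an edge within a layer has none.\<close>

definition back_edges :: "'a set \<Rightarrow> ('a \<Rightarrow> nat) \<Rightarrow> 'a \<Rightarrow> 'a set set" where
  "back_edges V r w = {e \<in> complete_edges V. w \<in> e \<and> (\<forall>u\<in>e - {w}. r u < r w)}"

lemma back_edges_disjoint: "v \<noteq> w \<Longrightarrow> back_edges V r v \<inter> back_edges V r w = {}"
proof (rule ccontr)
  assume "v \<noteq> w" "back_edges V r v \<inter> back_edges V r w \<noteq> {}"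
  then have "r v < r w" "r w < r v" by (auto simp: back_edges_def)
  then show False by simp
qed

lemma finite_back_edges: "finite V \<Longrightarrow> finite (back_edges V r w)"
  unfolding back_edges_def by (simp add: finite_complete_edges)

lemma back_edges_eq_image:
  assumes "w \<in> V"
  shows "back_edges V r w = (\<lambda>u. {w, u}) ` {u \<in> V. r u < r w}"
proof (intro equalityI subsetI)
  fix e assume "e \<in> back_edges V r w"
  then show "e \<in> (\<lambda>u. {w, u}) ` {u \<in> V. r u < r w}"
    unfolding back_edges_def by (auto elim!: complete_edges_other_end)
qed (use assms in \<open>auto simp: back_edges_def doubleton_in_complete_edges\<close>)

lemma inj_on_insert_singleton: "inj_on (\<lambda>u. {w, u}) S"
  by (auto simp: inj_on_def doubleton_eq_iff)

text \<open>
  Every vertex needs \<open>k\<close> back edges and should keep two free ones per missing edge. Enforcer's move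
  spoils this at one vertex \<open>z\<close> at most, by one, and claiming a back edge of \<open>z\<close> repairs it.
\<close>

lemma force_completion:
  assumes V: "finite V" and W: "W \<subseteq> V"
    and "A \<subseteq> D \<union> (\<Union>w\<in>W. back_edges V r w)"
    and "\<And>w. w \<in> W \<Longrightarrow> card (A \<inter> back_edges V r w) \<le> k"
    and "\<And>w. w \<in> W \<Longrightarrow> 2 * k \<le> card (back_edges V r w - (A \<union> E)) +
           2 * card (A \<inter> back_edges V r w) + (if w = z then 1 else 0)"
    and "j \<le> (\<Sum>w\<in>W. k - card (A \<inter> back_edges V r w))"
  shows "force (complete_edges V) j
           (\<lambda>A' E'. A' \<subseteq> D \<union> (\<Union>w\<in>W. back_edges V r w) \<and>
              (\<forall>w\<in>W. card (A' \<inter> back_edges V r w) \<le> k)) A E"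
  using assms(3-)
proof (induction j arbitrary: A E z)
  case 0
  then show ?case by simp
next
  case (Suc j)
  let ?B = "back_edges V r"
  have finB: "finite (?B w)" for w by (rule finite_back_edges[OF V])
  have finW: "finite W" using V W finite_subset by blast
  have "\<exists>w\<in>W. card (A \<inter> ?B w) < k"
  proof (rule ccontr)
    assume "\<not> ?thesis"
    then have "(\<Sum>w\<in>W. k - card (A \<inter> ?B w)) = 0" by (auto simp: not_less)
    with Suc.prems(4) show False by simp
  qed
  then obtain w' where w': "w' \<in> W" "card (A \<inter> ?B w') < k" by blast
  \<comment> \<open>Serve the vertex \<open>z\<close> damaged by Enforcer's last move if it still
    lacks back edges, otherwise any deficient vertex. If \<open>z\<close> is passed over, it already
    has its \<open>k\<close> edges and no longer needs free ones.\<close>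
  define w where "w = (if z \<in> W \<and> card (A \<inter> ?B z) < k then z else w')"
  have w: "w \<in> W" "card (A \<inter> ?B w) < k" using w' by (auto simp: w_def)
  have wz: "k \<le> card (A \<inter> ?B z)" if "z \<in> W" "z \<noteq> w"
    using that by (auto simp: w_def split: if_splits)
  have "0 < card (?B w - (A \<union> E))"
    using Suc.prems(3)[OF w(1)] w(2) by (auto split: if_splits)
  then have "?B w - (A \<union> E) \<noteq> {}" by force
  then obtain a where a: "a \<in> ?B w - (A \<union> E)" by blast
  have card_A: "card (insert a A \<inter> ?B v) = card (A \<inter> ?B v) + (if v = w then 1 else 0)" for v
    using a finB[of v] back_edges_disjoint[of v w V r] by (auto simp: Int_insert_left)
  have free_mid: "card (?B v - (A \<union> E)) \<le> card (?B v - (insert a A \<union> E)) + (if v = w then 1 else 0)" for v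
  proof (cases "v = w")
    case True
    have "?B v - (insert a A \<union> E) = (?B v - (A \<union> E)) - {a}" by auto
    then show ?thesis using True a finB[of v] by (simp add: card_Diff_singleton)
  next
    case False
    then have "?B v - (insert a A \<union> E) = ?B v - (A \<union> E)"
      using a back_edges_disjoint[of v w V r] by auto
    then show ?thesis by simp
  qed
  \<comment> \<open>At \<open>w\<close> one free edge is lost, but a claimed edge counts twice: the
    net gain of one pays for the correction term.\<close>
  have mid: "2 * k \<le> card (?B v - (insert a A \<union> E)) + 2 * card (insert a A \<inter> ?B v)" if "v \<in> W" for v
  proof (cases "v = z \<and> v \<noteq> w")
    case True
    then have "k \<le> card (A \<inter> ?B v)" using wz that by blast
    then show ?thesis using card_A[of v] by simp
  next
    case False
    then show ?thesis
      using Suc.prems(3)[OF that] free_mid[of v] card_A[of v] by (cases "v = w"; cases "v = z") simp_all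
  qed
  \<comment> \<open>The new \<open>z\<close> is the owner of Enforcer's edge \<open>b\<close>; if
    \<open>b\<close> has no owner, nothing is damaged and the arbitrary value of \<open>SOME\<close>
    is harmless.\<close>
  have "force (complete_edges V) j
           (\<lambda>A' E'. A' \<subseteq> D \<union> (\<Union>w\<in>W. back_edges V r w) \<and>
              (\<forall>w\<in>W. card (A' \<inter> back_edges V r w) \<le> k)) (insert a A) (insert b E)" for b
  proof (rule Suc.IH[where z = "SOME v. b \<in> ?B v"])
    show "insert a A \<subseteq> D \<union> (\<Union>w\<in>W. ?B w)" using Suc.prems(1) a w by auto
    show "card (insert a A \<inter> ?B v) \<le> k" if "v \<in> W" for v
      using Suc.prems(2)[OF that] card_A[of v] w by auto
    show "2 * k \<le> card (?B v - (insert a A \<union> insert b E)) + 2 * card (insert a A \<inter> ?B v) +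
        (if v = (SOME v. b \<in> ?B v) then 1 else 0)" if v: "v \<in> W" for v
    proof (cases "b \<in> ?B v")
      case True
      have "v = (SOME v. b \<in> ?B v)"
        by (rule someI2[of "\<lambda>v. b \<in> ?B v", OF True]) (use True back_edges_disjoint in \<open>metis disjoint_iff\<close>)
      moreover have "card (?B v - (insert a A \<union> E)) \<le> card (?B v - (insert a A \<union> insert b E)) + 1"
      proof -
        have "?B v - (insert a A \<union> insert b E) = (?B v - (insert a A \<union> E)) - {b}" by auto
        then show ?thesis
          using diff_card_le_card_Diff[of "{b}" "?B v - (insert a A \<union> E)"] by simp
      qed
      ultimately show ?thesis using mid[OF v] by simp
    next
      case False
      then have "?B v - (insert a A \<union> insert b E) = ?B v - (insert a A \<union> E)" by auto
      then show ?thesis using mid[OF v] by simp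
    qed
    have "(\<Sum>v\<in>W - {w}. k - card (insert a A \<inter> ?B v)) = (\<Sum>v\<in>W - {w}. k - card (A \<inter> ?B v))"
      by (intro sum.cong) (auto simp: card_A)
    then show "j \<le> (\<Sum>v\<in>W. k - card (insert a A \<inter> ?B v))"
      using Suc.prems(4) w card_A[of w] finW by (simp add: sum.remove[of W w])
  qed
  moreover have "a \<in> complete_edges V - (A \<union> E)" using a by (auto simp: back_edges_def)
  ultimately show ?case by auto
qed

text \<open>Edges from \<open>C\<close> to vertices outside \<open>L\<close> are allowed: they count
  towards the quota of their outer ends, so no move spent on the core is wasted.\<close>

definition core :: "'a set \<Rightarrow> 'a set \<Rightarrow> 'a set \<Rightarrow> 'a set set \<Rightarrow> bool" where
  "core V C L A \<longleftrightarrow> C \<subseteq> V \<and> L \<subseteq> V \<and> C \<inter> L = {} \<and> A \<subseteq> complete_edges V \<and>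
     (\<forall>e\<in>A. e \<inter> C \<noteq> {}) \<and> complete_edges C \<subseteq> A \<and> (\<forall>c\<in>C. \<forall>l\<in>L. {c, l} \<in> A)"

lemma card_Union_edges_le:
  assumes "finite V" "E \<subseteq> complete_edges V"
  shows "card (\<Union>E) \<le> 2 * card E"
proof -
  have "card (\<Union>E) \<le> sum card E" by (rule card_Union_le_sum_card)
  also have "\<dots> = (\<Sum>e\<in>E. 2)" using assms(2) by (intro sum.cong) (auto simp: complete_edges_def)
  finally show ?thesis by simp
qed

text \<open>The edges still to be made are covered by the missing parts of the quota
  \<open>k\<close> of the vertices outside \<open>C\<close>, so \<open>force_completion\<close>
  applies with \<open>complete_edges C\<close> as the fixed part.\<close>

lemma force_degenerate_from_core:
  fixes V :: "'a set"
  assumes V: "finite V" and core: "core V C L A"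
    and k: "card C = k" "k \<le> card L"
    and E: "E \<subseteq> complete_edges V" "3 * card E + 2 * k \<le> card V"
  shows "force (complete_edges V) ((card V - k) * k + (k choose 2) - card A)
           (\<lambda>A' E'. degenerate k V A') A E"
proof -
  define r :: "'a \<Rightarrow> nat" where
    "r w = (if w \<in> C then 0 else if w \<in> L then 1 else if w \<notin> \<Union>E then 2 else 3)" for w
  let ?B = "back_edges V r" and ?W = "V - C"
  have C: "C \<subseteq> V" "L \<subseteq> V" "C \<inter> L = {}" and A: "A \<subseteq> complete_edges V"
    and touch: "\<And>e. e \<in> A \<Longrightarrow> e \<inter> C \<noteq> {}" and CA: "complete_edges C \<subseteq> A"
    and CL: "\<And>c l. c \<in> C \<Longrightarrow> l \<in> L \<Longrightarrow> {c, l} \<in> A"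
    using core by (auto simp: core_def)
  have fin: "finite C" "finite L" "finite A" "finite E" "finite ?W" "finite (complete_edges V)"
    using V C A E finite_complete_edges[OF V] by (auto intro: finite_subset)
  have finB: "finite (?B w)" for w by (rule finite_back_edges[OF V])
  have A_sub: "A \<subseteq> complete_edges C \<union> (\<Union>w\<in>?W. ?B w)"
  proof
    fix e assume e: "e \<in> A"
    then obtain c where c: "c \<in> e" "c \<in> C" using touch by blast
    then obtain u where u: "e = {c, u}" "u \<noteq> c" "u \<in> V"
      using e A by (meson complete_edges_other_end subsetD)
    show "e \<in> complete_edges C \<union> (\<Union>w\<in>?W. ?B w)"
    proof (cases "u \<in> C")
      case True
      then show ?thesis using c u by (auto simp: doubleton_in_complete_edges)
    next
      case False
      then have "e \<in> ?B u"
        using c u C e A by (auto simp: back_edges_def r_def doubleton_in_complete_edges)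
      then show ?thesis using False u by auto
    qed
  qed
  have A_le: "card (A \<inter> ?B w) \<le> k" if w: "w \<in> ?W" for w
  proof -
    have "A \<inter> ?B w \<subseteq> (\<lambda>c. {w, c}) ` C"
      using w touch by (auto simp: back_edges_eq_image)
    then have "card (A \<inter> ?B w) \<le> card ((\<lambda>c. {w, c}) ` C)"
      using fin by (intro card_mono) auto
    also have "\<dots> = k" using k by (simp add: card_image inj_on_insert_singleton)
    finally show ?thesis .
  qed
  have card_B: "card (?B w) = card {u \<in> V. r u < r w}" if "w \<in> ?W" for w
    using that by (simp add: back_edges_eq_image card_image inj_on_insert_singleton)
  have split_B: "card (?B w) \<le> card (A \<inter> ?B w) + card (?B w - (A \<union> E)) + card (E \<inter> ?B w)" for w
  proof -
    have "card (?B w) \<le> card ((A \<inter> ?B w) \<union> (?B w - (A \<union> E)) \<union> (E \<inter> ?B w))"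
      using finB[of w] by (intro card_mono) auto
    also have "\<dots> \<le> card ((A \<inter> ?B w) \<union> (?B w - (A \<union> E))) + card (E \<inter> ?B w)"
      by (rule card_Un_le)
    also have "\<dots> \<le> card (A \<inter> ?B w) + card (?B w - (A \<union> E)) + card (E \<inter> ?B w)"
      using card_Un_le by simp
    finally show ?thesis .
  qed
  \<comment> \<open>Vertices of \<open>L\<close> have a full quota. An untouched vertex has all of
    \<open>C \<union> L\<close>, at least \<open>2 * k\<close> back neighbours, free of Enforcer's
    edges. A touched one has at least \<open>card V - 2 * card E\<close> back edges, of which
    Enforcer holds at most \<open>card E\<close>; hence the factor 3 in the assumption.\<close>
  have free: "2 * k \<le> card (?B w - (A \<union> E)) + 2 * card (A \<inter> ?B w)" if w: "w \<in> ?W" for w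
  proof -
    consider "w \<in> L" | "w \<notin> L" "w \<notin> \<Union>E" | "w \<notin> L" "w \<in> \<Union>E" by blast
    then show ?thesis
    proof cases
      case 1
      have "(\<lambda>c. {w, c}) ` C \<subseteq> A \<inter> ?B w"
        using w 1 C CL by (auto simp: back_edges_eq_image r_def insert_commute)
      then have "card ((\<lambda>c. {w, c}) ` C) \<le> card (A \<inter> ?B w)"
        using finB[of w] by (intro card_mono) auto
      then show ?thesis using k by (simp add: card_image inj_on_insert_singleton)
    next
      case 2
      have "card (C \<union> L) \<le> card {u \<in> V. r u < r w}"
        using w 2 C V by (intro card_mono) (auto simp: r_def)
      moreover have "card (C \<union> L) = k + card L"
        using fin C k by (simp add: card_Un_disjoint)
      moreover have "E \<inter> ?B w = {}" using 2 by (auto simp: back_edges_def)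
      ultimately show ?thesis using split_B[of w] card_B[OF w] k by simp
    next
      case 3
      have "card V - card (\<Union>E) \<le> card (V - \<Union>E)"
        by (rule diff_card_le_card_Diff) (use fin E finite_complete_edges in \<open>auto simp: complete_edges_def intro: finite_subset[OF _ V]\<close>)
      also have "\<dots> \<le> card {u \<in> V. r u < r w}"
        using w 3 V by (intro card_mono) (auto simp: r_def)
      finally have "card V - 2 * card E \<le> card (?B w)"
        using card_Union_edges_le[OF V E(1)] card_B[OF w] by simp
      moreover have "card (E \<inter> ?B w) \<le> card E" using fin by (intro card_mono) auto
      ultimately show ?thesis using split_B[of w] E(2) by simp
    qed
  qed
  \<comment> \<open>Bounding the claimed edges by \<open>card A\<close> turns
    \<open>e(n) - card A\<close> into a lower bound for the total missing quota.\<close>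
  have "(k choose 2) + (\<Sum>w\<in>?W. card (A \<inter> ?B w)) =
      card (complete_edges C) + card (\<Union>w\<in>?W. A \<inter> ?B w)"
    using fin k back_edges_disjoint[of _ _ V r]
    by (subst card_UN_disjoint) (auto simp: card_complete_edges)
  also have "\<dots> = card (complete_edges C \<union> (\<Union>w\<in>?W. A \<inter> ?B w))"
    using fin finite_complete_edges
    by (subst card_Un_disjoint) (auto simp: back_edges_def complete_edges_def)
  also have "\<dots> \<le> card A" using CA fin by (intro card_mono) auto
  finally have "(k choose 2) + (\<Sum>w\<in>?W. card (A \<inter> ?B w)) \<le> card A" .
  moreover have "(\<Sum>w\<in>?W. k - card (A \<inter> ?B w)) + (\<Sum>w\<in>?W. card (A \<inter> ?B w)) = (\<Sum>w\<in>?W. k)"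
    using A_le by (subst sum.distrib[symmetric]) (auto intro!: sum.cong)
  moreover have "(\<Sum>w\<in>?W. k) = (card V - k) * k"
    using C fin k by (simp add: card_Diff_subset)
  ultimately have "(card V - k) * k + (k choose 2) - card A \<le> (\<Sum>w\<in>?W. k - card (A \<inter> ?B w))"
    by linarith
  then have "force (complete_edges V) ((card V - k) * k + (k choose 2) - card A)
      (\<lambda>A' E'. A' \<subseteq> complete_edges C \<union> (\<Union>w\<in>?W. ?B w) \<and> (\<forall>w\<in>?W. card (A' \<inter> ?B w) \<le> k)) A E"
    using A_sub A_le free by (intro force_completion[OF V]) (auto simp: trans_le_add1)
  then show ?thesis
  proof (rule force_mono)
    fix A' E' :: "'a set set"
    assume A': "A' \<subseteq> complete_edges C \<union> (\<Union>w\<in>?W. ?B w) \<and> (\<forall>w\<in>?W. card (A' \<inter> ?B w) \<le> k)"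
    show "degenerate k V A'"
    proof (rule degenerate_if_rank[OF V])
      show "A' \<subseteq> complete_edges V"
        using A' complete_edges_mono[OF C(1)] by (auto simp: back_edges_def)
      fix v assume v: "v \<in> V"
      show "card {e \<in> A'. v \<in> e \<and> (\<forall>u\<in>e. r u \<le> r v)} \<le> k"
      proof (cases "v \<in> C")
        case True
        \<comment> \<open>In the lowest layer only edges inside \<open>C\<close> are
          counted.\<close>
        have "{e \<in> A'. v \<in> e \<and> (\<forall>u\<in>e. r u \<le> r v)} \<subseteq> (\<lambda>u. {v, u}) ` C"
        proof
          fix e assume e: "e \<in> {e \<in> A'. v \<in> e \<and> (\<forall>u\<in>e. r u \<le> r v)}"
          have "e \<notin> ?B w" if "w \<in> ?W" for w
            using e True that by (auto simp: back_edges_def r_def split: if_splits)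
          then have "e \<in> complete_edges C" using e A' by blast
          then show "e \<in> (\<lambda>u. {v, u}) ` C" using e by (auto elim!: complete_edges_other_end)
        qed
        then have "card {e \<in> A'. v \<in> e \<and> (\<forall>u\<in>e. r u \<le> r v)} \<le> card ((\<lambda>u. {v, u}) ` C)"
          using fin by (intro card_mono) auto
        then show ?thesis using k by (simp add: card_image inj_on_insert_singleton)
      next
        case False
        \<comment> \<open>Outside \<open>C\<close>, Avoider has no edge within a layer, so ties
          contribute nothing.\<close>
        have "{e \<in> A'. v \<in> e \<and> (\<forall>u\<in>e. r u \<le> r v)} \<subseteq> A' \<inter> ?B v"
        proof
          fix e assume e: "e \<in> {e \<in> A'. v \<in> e \<and> (\<forall>u\<in>e. r u \<le> r v)}"
          then have "e \<notin> complete_edges C" using False by (auto simp: complete_edges_def)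
          then obtain w where w: "w \<in> ?W" "e \<in> ?B w" using e A' by blast
          have "w = v"
          proof (rule ccontr)
            assume "w \<noteq> v"
            then have "r v < r w" "r w \<le> r v" using w e by (auto simp: back_edges_def)
            then show False by simp
          qed
          then show "e \<in> A' \<inter> ?B v" using w e by auto
        qed
        then have "card {e \<in> A'. v \<in> e \<and> (\<forall>u\<in>e. r u \<le> r v)} \<le> card (A' \<inter> ?B v)"
          using finB[of v] by (intro card_mono) auto
        then show ?thesis using A' v False by (meson DiffI le_trans)
      qed
    qed
  qed
qed

section \<open>Building a core\<close>

text \<open>A round uses up at most two elements of \<open>S\<close>: the one Avoider joins to
  \<open>v\<close> and the one Enforcer may block.\<close>

lemma force_star:
  assumes "finite S" "\<And>u. u \<in> S \<Longrightarrow> {v, u} \<in> X - (A \<union> E)" "2 * m \<le> card S"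
  shows "force X m (\<lambda>A' E'. \<exists>U\<subseteq>S. card U = m \<and> A' = A \<union> (\<lambda>u. {v, u}) ` U) A E"
  using assms
proof (induction m arbitrary: S A E)
  case 0
  have "\<exists>U\<subseteq>S. card U = 0 \<and> A = A \<union> (\<lambda>u. {v, u}) ` U" by (intro exI[of _ "{}"]) auto
  then show ?case by simp
next
  case (Suc m)
  then obtain u where u: "u \<in> S" by fastforce
  have "force X m (\<lambda>A' E'. \<exists>U\<subseteq>S. card U = Suc m \<and> A' = A \<union> (\<lambda>u. {v, u}) ` U)
      (insert {v, u} A) (insert b E)" if b: "b \<in> X - insert {v, u} (A \<union> E)" for b
  proof -
    define S' where "S' = S - {u} - {x \<in> S. {v, x} = b}"
    have "card {x \<in> S. {v, x} = b} \<le> 1"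
      using Suc.prems(1) by (subst card_le_Suc0_iff_eq[unfolded One_nat_def[symmetric]])
        (auto simp: doubleton_eq_iff)
    moreover have "card (S - {u}) - card {x \<in> S. {v, x} = b} \<le> card S'"
      unfolding S'_def using Suc.prems(1) by (intro diff_card_le_card_Diff) auto
    ultimately have "2 * m \<le> card S'" using Suc.prems u by simp
    moreover have "{v, x} \<in> X - (insert {v, u} A \<union> insert b E)" if "x \<in> S'" for x
      using that Suc.prems(2)[of x] unfolding S'_def by (auto simp: doubleton_eq_iff)
    ultimately have "force X m (\<lambda>A' E'. \<exists>U\<subseteq>S'. card U = m \<and>
        A' = insert {v, u} A \<union> (\<lambda>u. {v, u}) ` U) (insert {v, u} A) (insert b E)"
      using Suc.prems(1) by (intro Suc.IH) (auto simp: S'_def)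
    then show ?thesis
    proof (rule force_mono)
      fix A' E' assume "\<exists>U\<subseteq>S'. card U = m \<and> A' = insert {v, u} A \<union> (\<lambda>u. {v, u}) ` U"
      then obtain U where U: "U \<subseteq> S'" "card U = m" "A' = insert {v, u} A \<union> (\<lambda>u. {v, u}) ` U"
        by blast
      have "finite U" "u \<notin> U"
        using U(1) Suc.prems(1) finite_subset[of U S] by (auto simp: S'_def)
      then show "\<exists>U\<subseteq>S. card U = Suc m \<and> A' = A \<union> (\<lambda>u. {v, u}) ` U"
        using U u by (intro exI[of _ "insert u U"]) (auto simp: S'_def)
    qed
  qed
  then show ?case using Suc.prems(2)[OF u] by auto
qed

text \<open>Double counting: each edge contributes at most 2 to the degree sum over
  \<open>L\<close>, so the average is below \<open>d\<close>.\<close>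

lemma low_degree_vertex:
  assumes "finite L" "finite E" "\<And>e. e \<in> E \<Longrightarrow> card e = 2" "2 * card E < d * card L"
  obtains v where "v \<in> L" "card {e \<in> E. v \<in> e} < d"
proof -
  have "(\<Sum>v\<in>L. card {e \<in> E. v \<in> e}) = (\<Sum>v\<in>L. \<Sum>e\<in>E. if v \<in> e then 1 else 0)"
    using assms(2) by (simp add: sum.If_cases Int_def)
  also have "\<dots> = (\<Sum>e\<in>E. \<Sum>v\<in>L. if v \<in> e then 1 else 0)" by (rule sum.swap)
  also have "\<dots> = (\<Sum>e\<in>E. card (L \<inter> e))"
    using assms(1) by (simp add: sum.If_cases)
  also have "\<dots> \<le> (\<Sum>e\<in>E. 2)"
  proof (rule sum_mono)
    fix e assume "e \<in> E"
    then have "card e = 2" by (rule assms(3))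
    moreover from this have "finite e" by (metis card.infinite zero_neq_numeral)
    ultimately show "card (L \<inter> e) \<le> 2" by (metis card_mono inf_le2)
  qed
  finally have le: "(\<Sum>v\<in>L. card {e \<in> E. v \<in> e}) \<le> 2 * card E" by simp
  have "\<exists>v\<in>L. card {e \<in> E. v \<in> e} < d"
  proof (rule ccontr)
    assume "\<not> ?thesis"
    then have "(\<Sum>v\<in>L. d) \<le> (\<Sum>v\<in>L. card {e \<in> E. v \<in> e})"
      by (intro sum_mono) (auto simp: not_less)
    then show False using le assms(4) by (simp add: mult.commute)
  qed
  then show thesis using that by blast
qed

text \<open>Averaging gives \<open>v\<close> in \<open>L\<close> with at most
  \<open>2 * m - 1\<close> Enforcer edges, leaving \<open>2 * m\<close> usable partners among the
  other \<open>4 * m - 1\<close> candidates. Those joined to \<open>v\<close> form the new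
  \<open>L\<close>; being old candidates, they and \<open>v\<close> are already joined to
  \<open>C\<close>.\<close>

lemma force_core_step:
  assumes V: "finite V" and core: "core V C L A" and L: "card L = 4 * m"
    and E: "E \<subseteq> complete_edges V" "card E < 4 * m * m"
  shows "force (complete_edges V) m
    (\<lambda>A' E'. \<exists>C' L'. core V C' L' A' \<and> card C' = Suc (card C) \<and> card L' = m) A E"
proof -
  have fin: "finite C" "finite L" "finite E"
    using V core E finite_complete_edges[OF V] by (auto simp: core_def intro: finite_subset)
  obtain v where v: "v \<in> L" "card {e \<in> E. v \<in> e} < 2 * m"
    by (rule low_degree_vertex[OF fin(2,3), of "2 * m"])
      (use E L in \<open>auto simp: complete_edges_def\<close>)
  define S where "S = (L - {v}) - {u. {v, u} \<in> E}"
  have "card ((\<lambda>u. {v, u}) ` {u \<in> L. {v, u} \<in> E}) \<le> card {e \<in> E. v \<in> e}"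
    using fin by (intro card_mono) auto
  then have "card {u \<in> L. {v, u} \<in> E} < 2 * m"
    using v by (simp add: card_image inj_on_insert_singleton)
  moreover have "card (L - {v}) - card {u \<in> L. {v, u} \<in> E} \<le> card (L - {v} - {u \<in> L. {v, u} \<in> E})"
    using fin by (intro diff_card_le_card_Diff) auto
  moreover have "L - {v} - {u \<in> L. {v, u} \<in> E} = S" by (auto simp: S_def)
  ultimately have "2 * m \<le> card S" using L v fin by simp
  \<comment> \<open>Avoider has no edge inside \<open>L\<close>, since all his edges meet
    \<open>C\<close>.\<close>
  moreover have "{v, u} \<in> complete_edges V - (A \<union> E)" if "u \<in> S" for u
    using that v core by (auto simp: S_def core_def doubleton_in_complete_edges)
  ultimately have "force (complete_edges V) m
      (\<lambda>A' E'. \<exists>U\<subseteq>S. card U = m \<and> A' = A \<union> (\<lambda>u. {v, u}) ` U) A E"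
    using fin by (intro force_star) (auto simp: S_def)
  then show ?thesis
  proof (rule force_mono)
    fix A' E' assume "\<exists>U\<subseteq>S. card U = m \<and> A' = A \<union> (\<lambda>u. {v, u}) ` U"
    then obtain U where U: "U \<subseteq> S" "card U = m" "A' = A \<union> (\<lambda>u. {v, u}) ` U" by blast
    have vC: "v \<notin> C" and UL: "U \<subseteq> L - {v}" using core v U by (auto simp: core_def S_def)
    have "core V (insert v C) U A'"
      unfolding core_def
    proof (intro conjI ballI)
      show "insert v C \<subseteq> V" "U \<subseteq> V" "insert v C \<inter> U = {}"
        using core v UL by (auto simp: core_def)
      show "A' \<subseteq> complete_edges V"
        unfolding U(3) using core v UL by (auto simp: core_def doubleton_in_complete_edges subset_iff)
      show "e \<inter> insert v C \<noteq> {}" if "e \<in> A'" for e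
        using that U(3) core by (auto simp: core_def)
      show "complete_edges (insert v C) \<subseteq> A'"
      proof
        fix e assume e: "e \<in> complete_edges (insert v C)"
        show "e \<in> A'"
        proof (cases "v \<in> e")
          case True
          obtain c where "e = {v, c}" "c \<noteq> v" "c \<in> insert v C"
            using complete_edges_other_end[OF e True] by blast
          then show ?thesis using core v U(3) by (auto simp: core_def insert_commute)
        next
          case False
          then have "e \<in> complete_edges C" using e by (auto simp: complete_edges_def)
          then show ?thesis using core U(3) by (auto simp: core_def)
        qed
      qed
      show "{c, l} \<in> A'" if "c \<in> insert v C" "l \<in> U" for c l
        using that core UL U(3) by (auto simp: core_def)
    qed
    moreover have "card (insert v C) = Suc (card C)" using vC fin by simp
    ultimately show "\<exists>C' L'. core V C' L' A' \<and> card C' = Suc (card C) \<and> card L' = m"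
      using U(2) by blast
  qed
qed

text \<open>
  The edge budget \<open>16 ^ k\<close> is small compared with the square of every \<open>card L\<close>, so a vertex
  of \<open>L\<close> with many free edges into \<open>L\<close> is always available.
\<close>

lemma force_core:
  fixes V :: "'a set"
  assumes V: "finite V" "16 ^ k \<le> card V" and "i \<le> k"
  shows "\<exists>T. T + 4 ^ k * 4 ^ (k - i) \<le> 16 ^ k \<and> force (complete_edges V) T
    (\<lambda>A E. \<exists>C L. core V C L A \<and> card C = i \<and> card L = 4 ^ k * 4 ^ (k - i)) {} {}"
  using assms(3)
proof (induction i)
  case 0
  obtain L where "L \<subseteq> V" "card L = 16 ^ k" using V by (meson obtain_subset_with_card_n)
  then have "core V {} L {} \<and> card ({} :: 'a set) = 0 \<and> card L = 4 ^ k * 4 ^ (k - 0)"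
    by (auto simp: core_def complete_edges_def simp flip: power_mult_distrib)
  then have "\<exists>C L. core V C L {} \<and> card C = 0 \<and> card L = 4 ^ k * 4 ^ (k - 0)" by blast
  then show ?case
    by (intro exI[of _ 0]) (simp flip: power_mult_distrib)
next
  case (Suc i)
  define m :: nat where "m = 4 ^ k * 4 ^ (k - Suc i)"
  have m: "4 ^ k * 4 ^ (k - i) = 4 * m"
    using Suc.prems by (simp add: m_def Suc_diff_Suc flip: power_Suc)
  obtain T where T: "T + 4 * m \<le> 16 ^ k" and f: "force (complete_edges V) T
    (\<lambda>A E. \<exists>C L. core V C L A \<and> card C = i \<and> card L = 4 * m) {} {}"
    using Suc by (auto simp: m)
  \<comment> \<open>Even the last candidate set has size \<open>4 ^ k\<close>, so
    \<open>m * m\<close> is at least the whole budget \<open>16 ^ k\<close>.\<close>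
  have "(4::nat) ^ k * 4 ^ k \<le> m * m"
    unfolding m_def by (intro mult_mono) auto
  then have "(16::nat) ^ k \<le> m * m" by (simp flip: power_mult_distrib)
  moreover have "m > 0" by (simp add: m_def)
  ultimately have Tm: "T < 4 * m * m" using T by simp
  have "force (complete_edges V) T (force (complete_edges V) m
      (\<lambda>A' E'. \<exists>C' L'. core V C' L' A' \<and> card C' = Suc i \<and> card L' = m)) {} {}"
    by (rule force_mono[OF force_card[OF f]])
      (use V Tm finite_complete_edges in \<open>auto intro!: force_core_step\<close>)
  then have "force (complete_edges V) (T + m)
      (\<lambda>A' E'. \<exists>C' L'. core V C' L' A' \<and> card C' = Suc i \<and> card L' = m) {} {}"
    by (rule force_add)
  moreover have "T + m + m \<le> 16 ^ k" using T by simp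
  ultimately show ?case unfolding m_def[symmetric] by blast
qed

text \<open>The core takes \<open>T\<close> rounds, so both players then own \<open>T\<close> edges.
  As \<open>T\<close> and \<open>k\<close> are at most \<open>16 ^ k\<close>, the factor 5 yields
  \<open>3 * T + 2 * k \<le> card V\<close>.\<close>

lemma force_degenerate:
  fixes V :: "'a set"
  assumes V: "finite V" "5 * 16 ^ k \<le> card V"
  shows "force (complete_edges V) ((card V - k) * k + (k choose 2)) (\<lambda>A E. degenerate k V A) {} {}"
proof -
  let ?e = "(card V - k) * k + (k choose 2)"
  obtain T where T: "T + 4 ^ k \<le> 16 ^ k" and f: "force (complete_edges V) T
    (\<lambda>A E. \<exists>C L. core V C L A \<and> card C = k \<and> card L = 4 ^ k) {} {}"
    using force_core[of V k k] V by auto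
  have k4: "k \<le> 4 ^ k" by (simp add: less_imp_le power_gt_expt)
  have k16: "k \<le> 16 ^ k" by (simp add: less_imp_le power_gt_expt)
  \<comment> \<open>Ensures that the truncated \<open>?e - T\<close> is the true number of remaining
    rounds.\<close>
  have "T \<le> ?e"
  proof (cases "k = 0")
    case True
    then show ?thesis using T by simp
  next
    case False
    have "(card V - k) * 1 \<le> (card V - k) * k" using False by (intro mult_left_mono) auto
    then show ?thesis using T V k16 by linarith
  qed
  have "force (complete_edges V) T (force (complete_edges V) (?e - T) (\<lambda>A E. degenerate k V A)) {} {}"
  proof (rule force_mono[OF force_card[OF f]])
    fix A E :: "'a set set"
    assume *: "(\<exists>C L. core V C L A \<and> card C = k \<and> card L = 4 ^ k) \<and>
      A \<subseteq> complete_edges V \<and> E \<subseteq> complete_edges V \<and> A \<inter> E = {} \<and>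
      card A = card ({} :: 'a set set) + T \<and> card E = card ({} :: 'a set set) + T"
    then obtain C L where C: "core V C L A" "card C = k" "card L = 4 ^ k" by blast
    have "3 * card E + 2 * k \<le> card V" 
    proof -
      have "card E = T" using * by simp
      then show ?thesis using T V(2) k16 by linarith
    qed
    then show "force (complete_edges V) (?e - T) (\<lambda>A E. degenerate k V A) A E"
      using force_degenerate_from_core[OF V(1) C(1,2), of E] C(3) k4 * by simp
  qed (use V finite_complete_edges in auto)
  then have "force (complete_edges V) (T + (?e - T)) (\<lambda>A E. degenerate k V A) {} {}"
    by (rule force_add)
  then show ?thesis using \<open>T \<le> ?e\<close> by simp
qed

section \<open>The threshold\<close>

lemma enforcer_wins_within_max_degenerate_edges:
  assumes "k \<le> n" "2 * max_degenerate_edges n k + 1 \<le> n choose 2"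
  shows "enforcer_wins_within (complete_edges {..<n}) (non_degenerate_hypergraph n k)
           (max_degenerate_edges n k + 1)"
proof -
  let ?X = "complete_edges {..<n}" and ?t = "max_degenerate_edges n k + 1"
  obtain s where s: "enforcer_strategy ?X s" using enforcer_strategy_exists by blast
  have "avoider_claims ?t p \<in> non_degenerate_hypergraph n k" if p: "complete_play ?X p" for p
  proof -
    have "length p = n choose 2"
      using p by (metis complete_play_def distinct_card card_complete_edges finite_lessThan card_lessThan)
    then have card: "card (avoider_claims ?t p) = ?t"
      using p assms(2) by (intro card_avoider_claims) (auto simp: complete_play_def)
    have graph: "is_graph {..<n} (avoider_claims ?t p)"
      using p nth_mem by (fastforce simp: is_graph_def avoider_claims_def complete_play_def)
    have "\<not> degenerate k {..<n} (avoider_claims ?t p)"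
      using degenerate_card_le[OF _ _ graph, of k] card assms(1)
      by (auto simp: max_degenerate_edges_def)
    with graph show ?thesis by (simp add: non_degenerate_hypergraph_def)
  qed
  with s show ?thesis unfolding enforcer_wins_within_def by blast
qed

text \<open>Each \<open>s\<close> admits a play in which Avoider's claims stay degenerate; a losing
  set inside them would inherit degeneracy.\<close>

lemma not_enforcer_wins_within_max_degenerate_edges:
  assumes "5 * 16 ^ k \<le> n" "2 * max_degenerate_edges n k \<le> n choose 2"
    and "t \<le> max_degenerate_edges n k"
  shows "\<not> enforcer_wins_within (complete_edges {..<n}) (non_degenerate_hypergraph n k) t"
proof
  let ?X = "complete_edges {..<n}"
  assume "enforcer_wins_within ?X (non_degenerate_hypergraph n k) t"
  then obtain s where s: "enforcer_strategy ?X s"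
    and win: "\<And>p. complete_play ?X p \<Longrightarrow> follows s p \<Longrightarrow>
      \<exists>A\<in>non_degenerate_hypergraph n k. A \<subseteq> avoider_claims t p"
    unfolding enforcer_wins_within_def by blast
  have force: "force ?X (max_degenerate_edges n k) (\<lambda>A E. degenerate k {..<n} A) {} {}"
    using force_degenerate[of "{..<n}" k] assms(1) by (simp add: max_degenerate_edges_def)
  have "2 * max_degenerate_edges n k \<le> card ?X"
    using assms(2) by (simp add: card_complete_edges)
  then obtain p where p: "complete_play ?X p" "follows s p"
    "degenerate k {..<n} (avoider_claims (max_degenerate_edges n k) p)"
    using force_play[OF s finite_complete_edges[OF finite_lessThan] force] by blast
  from p(3) have "degenerate k {..<n} (avoider_claims t p)"
    by (rule degenerate_subset[OF _ avoider_claims_mono[OF assms(3)]])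
  then show False
    using win[OF p(1,2)] by (auto simp: non_degenerate_hypergraph_def dest: degenerate_subset)
qed

text \<open>The board has room for all rounds considered: \<open>e(n) \<le> n * k\<close> and
  \<open>4 * k + 1 \<le> n - 1\<close>.\<close>

lemma two_max_degenerate_edges_less:
  assumes "5 * 16 ^ k \<le> n"
  shows "2 * max_degenerate_edges n k + 1 \<le> n choose 2"
proof -
  have "k + 1 \<le> 16 ^ k" by (simp add: Suc_leI power_gt_expt)
  then have n: "5 * k + 5 \<le> n" using assms by linarith
  have "(n - k) * k + (k choose 2) \<le> (n - k) * k + k * k"
    by (cases k) (auto simp: choose_two intro: le_trans[OF div_le_dividend])
  also have "\<dots> = n * k"
    using n by (simp add: add_mult_distrib[symmetric])
  finally have "4 * max_degenerate_edges n k \<le> n * (4 * k)"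
    by (simp add: max_degenerate_edges_def)
  moreover have "n * (4 * k) + n * 1 \<le> n * (n - 1)"
    unfolding add_mult_distrib2[symmetric] using n by (intro mult_left_mono) auto
  ultimately have "4 * max_degenerate_edges n k + 2 \<le> n * (n - 1)"
    using n by linarith
  then have "(4 * max_degenerate_edges n k + 2) div 2 \<le> n * (n - 1) div 2"
    by (rule div_le_mono)
  then show ?thesis by (simp add: choose_two)
qed

lemma tau_E_non_degenerate_hypergraph:
  assumes "5 * 16 ^ k \<le> n"
  shows "tau_E (complete_edges {..<n}) (non_degenerate_hypergraph n k) =
           enat (max_degenerate_edges n k + 1)"
  unfolding tau_E_def
proof (intro antisym Inf_lower Inf_greatest)
  have "k \<le> 16 ^ k" by (simp add: less_imp_le power_gt_expt)
  then have "k \<le> n" using assms by linarith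
  then show "enat (max_degenerate_edges n k + 1) \<in>
      {enat t |t. enforcer_wins_within (complete_edges {..<n}) (non_degenerate_hypergraph n k) t}"
    using enforcer_wins_within_max_degenerate_edges two_max_degenerate_edges_less[OF assms] by blast
  show "enat (max_degenerate_edges n k + 1) \<le> x"
    if "x \<in> {enat t |t. enforcer_wins_within (complete_edges {..<n}) (non_degenerate_hypergraph n k) t}" for x
  proof -
    obtain t where t: "x = enat t"
      "enforcer_wins_within (complete_edges {..<n}) (non_degenerate_hypergraph n k) t"
      using \<open>x \<in> _\<close> by blast
    have "\<not> t \<le> max_degenerate_edges n k"
      using not_enforcer_wins_within_max_degenerate_edges[OF assms, of t] t(2)
        two_max_degenerate_edges_less[OF assms] by linarith
    then show ?thesis using t(1) by simp
  qed
qed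

lemma eventually_16_power_le:
  fixes k :: "nat \<Rightarrow> nat"
  assumes "(\<lambda>n. real (k n)) \<in> o(\<lambda>n. ln (real n))"
  shows "\<forall>\<^sub>F n in sequentially. 5 * 16 ^ k n \<le> n"
proof -
  \<comment> \<open>With \<open>ln 16 \<le> 4\<close>, the constant \<open>1 / 8\<close> gives
    \<open>16 ^ k n \<le> sqrt n\<close>; the other factor \<open>sqrt n\<close> absorbs the 5 once
    \<open>n \<ge> 25\<close>.\<close>
  have "\<forall>\<^sub>F n in sequentially. norm (real (k n)) \<le> 1 / 8 * norm (ln (real n))"
    using assms by (rule landau_o.smallD) simp
  then show ?thesis
    using eventually_ge_at_top[of "25 :: nat"]
  proof eventually_elim
    case (elim n)
    have "ln (2 :: real) \<le> 1" using ln_le_minus_one[of 2] by simp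
    then have "ln (16 :: real) \<le> 4"
      using ln_realpow[of "2 :: real" 4] by simp
    then have "real (k n) * ln 16 \<le> real (k n) * 4" by (intro mult_left_mono) auto
    also have "\<dots> \<le> ln (real n) / 2" using elim by simp
    also have "\<dots> = ln (sqrt (real n))" using elim by (simp add: ln_sqrt)
    finally have "ln (16 ^ k n) \<le> ln (sqrt (real n))" by (simp add: ln_realpow)
    then have *: "16 ^ k n \<le> sqrt (real n)" using elim by simp
    have "5 \<le> sqrt (real n)" using elim by (intro real_le_rsqrt) auto
    then have "5 * 16 ^ k n \<le> sqrt (real n) * sqrt (real n)"
      using * by (intro mult_mono) auto
    then have "real (5 * 16 ^ k n) \<le> real n" by simp
    then show ?case by (simp only: of_nat_le_iff)
  qed
qed

theorem theorem3:
  fixes k :: "nat \<Rightarrow> nat"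
  assumes "\<And>n. k n \<ge> 1"
    and "(\<lambda>n. real (k n)) \<in> o(\<lambda>n. ln (real n))"
  shows "\<forall>\<^sub>F n in sequentially.
           tau_E (complete_edges {..<n}) (non_degenerate_hypergraph n (k n)) =
             enat (max_degenerate_edges n (k n) + 1)"
  using eventually_16_power_le[OF assms(2)] tau_E_non_degenerate_hypergraph
  by (rule eventually_mono)

end
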